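(* For any graph $G$, $\alpha(G)\le\alpha_q(G)\le\alpha^\star(G)\le\lfloor\vartheta'(G)\rfloor$.
   Context: Graphs are finite, undirected, without loops, with at least one vertex; $[t]=\{1,\dots,t\}$; $u\simeq v$ means $u=v$ or $u,v$ adjacent. $\alpha(G)$ is the maximum cardinality of a stable (independent) set. $\mathcal S^d$ denotes the real symmetric $d\times d$ matrices with trace inner product $\langle X,Y\rangle=\mathrm{Tr}(XY)$, and $\mathcal S^d_+$ the positive semidefinite ones; $J$ is the all-ones matrix; $\mathcal{DNN}^n$ is the cone of positive semidefinite matrices in $\mathcal S^n$ with nonnegative entries. $\alpha_q(G)$ is the maximum $t\in\mathbb N$ for which there exist $d\ge1$ and $\rho,\rho_i^u\in\mathcal S^d_+$ ($i\in[t]$, $u\in V(G)$) with: (a) $\langle\rho,\rho\rangle=1$; (b) $\sum_{u\in V(G)}\rho_i^u=\rho$ for all $i\in[t]$; (c) $\langle\rho_i^u,\rho_j^v\rangle=0$ for all $i\ne j\in[t]$ and $u\simeq v\in V(G)$; (d) $\langle\rho_i^u,\rho_i^v\rangle=0$ for all $i\in[t]$ and $u\ne v\in V(G)$. $\alpha^\star(G)$ is defined in the same way with only conditions (a), (b), (c). With $n=|V(G)|$, $\vartheta'(G)=\max\{\langle J,X\rangle: X\in\mathcal{DNN}^n,\ \mathrm{Tr}(X)=1,\ X_{uv}=0\ \forall\{u,v\}\in E(G)\}$. *)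

theory Defs
  imports
    Complex_Main
    "Jordan_Normal_Form.Matrix"
    "Graph_Theory.Pair_Digraph"
begin

text \<open>
  A finite undirected graph without loops is a \<^locale>\<open>pair_graph\<close>: every edge is represented
  by its two opposite arcs, so that \<open>(u, v) \<in> parcs G\<close> means that \<open>u\<close> and \<open>v\<close> are adjacent.
\<close>

definition equal_or_adjacent :: "'a pair_pre_digraph \<Rightarrow> 'a \<Rightarrow> 'a \<Rightarrow> bool" where
  "equal_or_adjacent G u v \<longleftrightarrow> u = v \<or> (u, v) \<in> parcs G"

definition stable_set :: "'a pair_pre_digraph \<Rightarrow> 'a set \<Rightarrow> bool" where
  "stable_set G S \<longleftrightarrow> S \<subseteq> pverts G \<and> (\<forall>u\<in>S. \<forall>v\<in>S. (u, v) \<notin> parcs G)"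

definition stability_number :: "'a pair_pre_digraph \<Rightarrow> nat" where
  "stability_number G = Max {card S | S. stable_set G S}"

definition sym_mats :: "nat \<Rightarrow> real mat set" where
  "sym_mats d = {A \<in> carrier_mat d d. transpose_mat A = A}"

definition psd_mats :: "nat \<Rightarrow> real mat set" where
  "psd_mats d = {A \<in> sym_mats d. \<forall>x \<in> carrier_vec d. x \<bullet> (A *\<^sub>v x) \<ge> 0}"

definition dnn_mats :: "nat \<Rightarrow> real mat set" where
  "dnn_mats d = {A \<in> psd_mats d. \<forall>i<d. \<forall>j<d. A $$ (i, j) \<ge> 0}"

definition all_ones_mat :: "nat \<Rightarrow> real mat" where
  "all_ones_mat d = mat d d (\<lambda>_. 1)"

definition mat_trace :: "real mat \<Rightarrow> real" where
  "mat_trace A = (\<Sum>i<dim_row A. A $$ (i, i))"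

definition trace_inner :: "real mat \<Rightarrow> real mat \<Rightarrow> real" where
  "trace_inner X Y = mat_trace (X * Y)"

text \<open>
  \<open>P i u\<close> is the matrix $\rho_i^u$; only its values for \<open>i \<in> {1..t}\<close> and \<open>u \<in> pverts G\<close> matter.
  The sum over the vertices is taken in the additive group of \<open>d \<times> d\<close> matrices, since the type
  \<^typ>\<open>real mat\<close> contains the matrices of all sizes and has no common zero.
\<close>

definition alpha_star_feasible ::
  "'a pair_pre_digraph \<Rightarrow> nat \<Rightarrow> nat \<Rightarrow> real mat \<Rightarrow> (nat \<Rightarrow> 'a \<Rightarrow> real mat) \<Rightarrow> bool" where
  "alpha_star_feasible G t d \<rho> P \<longleftrightarrow>
     \<rho> \<in> psd_mats d \<and>
     (\<forall>i\<in>{1..t}. \<forall>u\<in>pverts G. P i u \<in> psd_mats d) \<and>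
     trace_inner \<rho> \<rho> = 1 \<and>
     (\<forall>i\<in>{1..t}. finsum (module_mat TYPE(real) d d) (\<lambda>u. P i u) (pverts G) = \<rho>) \<and>
     (\<forall>i\<in>{1..t}. \<forall>j\<in>{1..t}. i \<noteq> j \<longrightarrow>
        (\<forall>u\<in>pverts G. \<forall>v\<in>pverts G. equal_or_adjacent G u v \<longrightarrow>
           trace_inner (P i u) (P j v) = 0))"

definition alpha_q_feasible ::
  "'a pair_pre_digraph \<Rightarrow> nat \<Rightarrow> nat \<Rightarrow> real mat \<Rightarrow> (nat \<Rightarrow> 'a \<Rightarrow> real mat) \<Rightarrow> bool" where
  "alpha_q_feasible G t d \<rho> P \<longleftrightarrow>
     alpha_star_feasible G t d \<rho> P \<and>
     (\<forall>i\<in>{1..t}. \<forall>u\<in>pverts G. \<forall>v\<in>pverts G. u \<noteq> v \<longrightarrow>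
        trace_inner (P i u) (P i v) = 0)"

definition alpha_q :: "'a pair_pre_digraph \<Rightarrow> nat" where
  "alpha_q G = (GREATEST t. \<exists>d\<ge>1. \<exists>\<rho> P. alpha_q_feasible G t d \<rho> P)"

definition alpha_star :: "'a pair_pre_digraph \<Rightarrow> nat" where
  "alpha_star G = (GREATEST t. \<exists>d\<ge>1. \<exists>\<rho> P. alpha_star_feasible G t d \<rho> P)"

text \<open>
  The rows and columns of the matrix \<open>X\<close> are indexed by the vertices via a list \<open>vs\<close> that
  enumerates \<open>pverts G\<close> without repetition. Letting \<open>vs\<close> range over all enumerations does not
  affect the set of values $\langle J, X\rangle$, as a change of enumeration permutes the rows
  and columns of \<open>X\<close> simultaneously. For a real-valued objective, \<open>GREATEST\<close> denotes an
  attained maximum, not merely a supremum.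
\<close>

definition theta_prime_feasible :: "'a pair_pre_digraph \<Rightarrow> 'a list \<Rightarrow> real mat \<Rightarrow> bool" where
  "theta_prime_feasible G vs X \<longleftrightarrow>
     X \<in> dnn_mats (card (pverts G)) \<and>
     mat_trace X = 1 \<and>
     (\<forall>i<card (pverts G). \<forall>j<card (pverts G). (vs ! i, vs ! j) \<in> parcs G \<longrightarrow> X $$ (i, j) = 0)"

definition theta_prime :: "'a pair_pre_digraph \<Rightarrow> real" where
  "theta_prime G =
     (GREATEST r. \<exists>vs X. distinct vs \<and> set vs = pverts G \<and> theta_prime_feasible G vs X \<and>
        r = trace_inner (all_ones_mat (card (pverts G))) X)"

end

theory Submission
  imports Defs "HOL-Analysis.Function_Topology"
begin

text \<open>
  The first inequality comes from the indicator families in dimension \<open>d = 1\<close>, the second from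
  dropping condition (d). For the third, write $g_{iu,jv} = \langle\rho_i^u, \rho_j^v\rangle \ge 0$
  and $a_u = \sum_i \sum_v g_{iu,iv}$, and take
  $$X = \frac1t \Bigl(\mathrm{Diag}(a) + \Bigl(\sum_{i \ne j} g_{iu,jv}\Bigr)_{u,v}\Bigr).$$
  By (c) the second summand vanishes on the diagonal and on the edges, so $\mathrm{Tr}(X) = 1$ by
  (a) and (b), while $\langle J, X\rangle = (t + t(t-1))/t = t$. Finally $tX$ is positive
  semidefinite, being the sum of the Gram matrix of the vectors $\sum_i \rho_i^u$ and of the weighted
  graph Laplacians $\mathrm{Diag}(\sum_v g_{iu,iv}) - (g_{iu,iv})_{u,v}$. Replacing the diagonal
  blocks by their row sums is what makes condition (d) superfluous.
  The maximum defining $\vartheta'$ is attained because the feasible kernels form a compact set.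
\<close>

section \<open>Positive semidefinite kernels on a finite set\<close>

text \<open>Kernels on an arbitrary index set cover both matrix rows and graph vertices, and a point
  can be eliminated without renumbering. Only the values of \<open>x\<close> on \<open>V\<close>
  enter the form.\<close>

definition psd_on :: "'b set \<Rightarrow> ('b \<Rightarrow> 'b \<Rightarrow> real) \<Rightarrow> bool" where
  "psd_on V a \<longleftrightarrow> (\<forall>u\<in>V. \<forall>v\<in>V. a u v = a v u) \<and>
     (\<forall>x. 0 \<le> (\<Sum>u\<in>V. \<Sum>v\<in>V. x u * x v * a u v))"

lemma psd_on_sym: "psd_on V a \<Longrightarrow> u \<in> V \<Longrightarrow> v \<in> V \<Longrightarrow> a u v = a v u"
  unfolding psd_on_def by blast

lemma psd_on_nonneg: "psd_on V a \<Longrightarrow> 0 \<le> (\<Sum>u\<in>V. \<Sum>v\<in>V. x u * x v * a u v)"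
  unfolding psd_on_def by blast

lemma psd_on_cong:
  assumes "\<And>u v. u \<in> V \<Longrightarrow> v \<in> V \<Longrightarrow> a u v = b u v"
  shows "psd_on V a \<longleftrightarrow> psd_on V b"
  unfolding psd_on_def by (simp add: assms cong: sum.cong)

text \<open>Needed in both directions: from rows to vertices and from vertices to rows. A test
  function on \<open>A\<close> is pushed forward along \<open>h\<close> to one on
  \<open>B\<close>.\<close>

lemma psd_on_reindex:
  assumes "psd_on B a" and h: "bij_betw h A B"
  shows "psd_on A (\<lambda>i j. a (h i) (h j))"
  unfolding psd_on_def
proof (intro conjI ballI allI)
  show "a (h u) (h v) = a (h v) (h u)" if "u \<in> A" "v \<in> A" for u v
    using psd_on_sym[OF assms(1)] bij_betwE[OF h] that by blast
  fix x :: "_ \<Rightarrow> real"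
  define y where "y = x \<circ> inv_into A h"
  have y: "y (h i) = x i" if "i \<in> A" for i
    using h that by (auto simp: y_def bij_betw_inv_into_left)
  have "0 \<le> (\<Sum>u\<in>B. \<Sum>v\<in>B. y u * y v * a u v)"
    using assms(1) by (rule psd_on_nonneg)
  also have "\<dots> = (\<Sum>i\<in>A. \<Sum>j\<in>A. y (h i) * y (h j) * a (h i) (h j))"
    by (simp flip: sum.reindex_bij_betw[OF h])
  also have "\<dots> = (\<Sum>i\<in>A. \<Sum>j\<in>A. x i * x j * a (h i) (h j))"
    by (simp add: y cong: sum.cong)
  finally show "0 \<le> (\<Sum>i\<in>A. \<Sum>j\<in>A. x i * x j * a (h i) (h j))" .
qed

lemma psd_on_diag_nonneg:
  assumes "finite V" "psd_on V a" "u \<in> V"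
  shows "0 \<le> a u u"
proof -
  define x :: "'a \<Rightarrow> real" where "x w = (if w = u then 1 else 0)" for w
  have "0 \<le> (\<Sum>w\<in>V. \<Sum>w'\<in>V. x w * x w' * a w w')"
    using assms(2) by (rule psd_on_nonneg)
  also have "\<dots> = (\<Sum>w\<in>{u}. \<Sum>w'\<in>{u}. x w * x w' * a w w')"
    using assms by (intro sum.mono_neutral_cong_right) (auto simp: x_def intro!: sum.mono_neutral_right)
  finally show ?thesis by (simp add: x_def)
qed

lemma psd_on_two_points:
  assumes "finite V" "psd_on V a" "u \<in> V" "v \<in> V" "u \<noteq> v"
  shows "0 \<le> s\<^sup>2 * a u u + 2 * s * t * a u v + t\<^sup>2 * a v v"
proof -
  define x where "x w = (if w = u then s else if w = v then t else 0)" for w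
  have "0 \<le> (\<Sum>w\<in>V. \<Sum>w'\<in>V. x w * x w' * a w w')"
    using assms(2) by (rule psd_on_nonneg)
  also have "\<dots> = (\<Sum>w\<in>{u, v}. \<Sum>w'\<in>{u, v}. x w * x w' * a w w')"
    using assms by (intro sum.mono_neutral_cong_right) (auto simp: x_def intro!: sum.mono_neutral_right)
  also have "\<dots> = s\<^sup>2 * a u u + 2 * s * t * a u v + t\<^sup>2 * a v v"
    using assms psd_on_sym[OF assms(2), of v u] by (simp add: x_def power2_eq_square)
  finally show ?thesis .
qed

text \<open>Once \<open>a u u\<close> vanishes, the two-point form is affine in \<open>s\<close>,
  and a nonzero slope \<open>2 * a u v\<close> would make it negative somewhere.\<close>

lemma psd_on_zero_diag:
  assumes "finite V" "psd_on V a" "u \<in> V" "v \<in> V" "a u u = 0"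
  shows "a u v = 0"
proof (rule ccontr)
  assume nz: "a u v \<noteq> 0"
  then have "u \<noteq> v" using assms by auto
  \<comment> \<open>This choice of \<open>s\<close> gives the form the value -1 at
    \<open>t = 1\<close>.\<close>
  from psd_on_two_points[OF assms(1-4) this, of "- (a v v + 1) / (2 * a u v)" 1]
  show False using nz assms(5) by (simp add: field_simps)
qed

lemma quadratic_form_insert:
  fixes a :: "'b \<Rightarrow> 'b \<Rightarrow> real"
  assumes "finite V" "z \<notin> V" "\<And>u. u \<in> V \<Longrightarrow> a u z = a z u"
  shows "(\<Sum>u\<in>insert z V. \<Sum>v\<in>insert z V. x u * x v * a u v) =
    (x z)\<^sup>2 * a z z + 2 * x z * (\<Sum>u\<in>V. x u * a z u) + (\<Sum>u\<in>V. \<Sum>v\<in>V. x u * x v * a u v)"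
proof -
  have "(\<Sum>u\<in>V. x u * x z * a u z) = x z * (\<Sum>u\<in>V. x u * a z u)"
    "(\<Sum>v\<in>V. x z * x v * a z v) = x z * (\<Sum>u\<in>V. x u * a z u)"
    by (simp_all add: sum_distrib_left assms(3) mult_ac cong: sum.cong)
  then show ?thesis
    using assms(1,2) by (simp add: sum.distrib power2_eq_square algebra_simps)
qed

text \<open>
  Elimination of \<open>z\<close>; if \<open>a z z = 0\<close>, then the row of \<open>z\<close> vanishes and the division by zero
  correctly subtracts \<open>0\<close>.
\<close>

lemma psd_on_schur_complement:
  assumes "finite V" "z \<notin> V" "psd_on (insert z V) a"
  shows "psd_on V (\<lambda>u v. a u v - a z u * a z v / a z z)"
  unfolding psd_on_def
proof (intro conjI ballI allI)
  have sym: "a u v = a v u" if "u \<in> insert z V" "v \<in> insert z V" for u v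
    using assms(3) that by (rule psd_on_sym)
  show "a u v - a z u * a z v / a z z = a v u - a z v * a z u / a z z" if "u \<in> V" "v \<in> V" for u v
    using that sym[of u v] by (simp add: mult.commute)
  fix x :: "'a \<Rightarrow> real"
  define S where "S = (\<Sum>u\<in>V. x u * a z u)"
  \<comment> \<open>For \<open>a z z > 0\<close> this is the minimizer of the form in the free
    coordinate at \<open>z\<close>; the minimum is the form of the Schur complement.\<close>
  define y where "y = x(z := - S / a z z)"
  have yV: "y u = x u" if "u \<in> V" for u
    using that assms(2) by (auto simp: y_def)
  have "0 \<le> (\<Sum>u\<in>insert z V. \<Sum>v\<in>insert z V. y u * y v * a u v)"
    using assms(3) by (rule psd_on_nonneg)
  also have "\<dots> = (y z)\<^sup>2 * a z z + 2 * y z * S + (\<Sum>u\<in>V. \<Sum>v\<in>V. x u * x v * a u v)"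
    using assms(1,2) sym by (subst quadratic_form_insert) (auto simp: S_def yV cong: sum.cong)
  also have "\<dots> = (\<Sum>u\<in>V. \<Sum>v\<in>V. x u * x v * a u v) - S * S / a z z"
    by (cases "a z z = 0") (simp_all add: y_def power2_eq_square field_simps)
  also have "S * S / a z z = (\<Sum>u\<in>V. \<Sum>v\<in>V. x u * x v * (a z u * a z v / a z z))"
    unfolding S_def sum_product sum_divide_distrib by (intro sum.cong refl) simp
  finally show "0 \<le> (\<Sum>u\<in>V. \<Sum>v\<in>V. x u * x v * (a u v - a z u * a z v / a z z))"
    by (simp add: right_diff_distrib sum_subtractf)
qed

section \<open>Gram factorization and self-duality of the positive semidefinite cone\<close>

text \<open>Cholesky factorization: each eliminated point contributes one rank-one term, and
  induction factors the Schur complement that remains.\<close>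

lemma psd_on_gram:
  assumes "finite V" "psd_on V a"
  shows "\<exists>(N::nat) w. \<forall>u\<in>V. \<forall>v\<in>V. a u v = (\<Sum>k<N. w k u * w k v)"
  using assms
proof (induction V arbitrary: a rule: finite_induct)
  case empty
  then show ?case by simp
next
  case (insert z V)
  from insert.IH[OF psd_on_schur_complement[OF insert.hyps insert.prems]]
  obtain N :: nat and w
    where w: "\<And>u v. u \<in> V \<Longrightarrow> v \<in> V \<Longrightarrow> a u v - a z u * a z v / a z z = (\<Sum>k<N. w k u * w k v)"
    by blast
  have fin: "finite (insert z V)" using insert.hyps by simp
  have diag: "0 \<le> a z z"
    using psd_on_diag_nonneg[OF fin insert.prems] by simp
  \<comment> \<open>The old vectors are extended by 0 at \<open>z\<close>; index \<open>N\<close>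
    carries the rank-one term that the Schur complement subtracts.\<close>
  define w' where
    "w' k u = (if k < N then if u = z then 0 else w k u else a z u / sqrt (a z z))" for k u
  have "a u v = (\<Sum>k<Suc N. w' k u * w' k v)" if uv: "u \<in> insert z V" "v \<in> insert z V" for u v
  proof -
    have "(\<Sum>k<Suc N. w' k u * w' k v) =
        (if u = z \<or> v = z then 0 else \<Sum>k<N. w k u * w k v) + a z u * a z v / a z z"
      by (simp add: w'_def diag)
    also have "\<dots> = a u v"
    \<comment> \<open>In the row and column of \<open>z\<close> only the new term survives. It
      equals \<open>a u v\<close>, and for \<open>a z z = 0\<close> both sides are 0.\<close>
    proof (cases "u = z \<or> v = z")
      case True
      then show ?thesis
        using psd_on_zero_diag[OF fin insert.prems, of z] psd_on_sym[OF insert.prems, of u v] uv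
        by (cases "a z z = 0") auto
    next
      case False
      then show ?thesis using uv by (simp flip: w)
    qed
    finally show ?thesis by simp
  qed
  then show ?case by blast
qed

text \<open>A Gram factorization of \<open>a\<close> turns the inner product into a sum of values of
  the quadratic form of \<open>b\<close>.\<close>

lemma psd_on_inner_nonneg:
  assumes "finite V" "psd_on V a" "psd_on V b"
  shows "0 \<le> (\<Sum>u\<in>V. \<Sum>v\<in>V. a u v * b u v)"
proof -
  from psd_on_gram[OF assms(1,2)] obtain N :: nat and w
    where w: "\<And>u v. u \<in> V \<Longrightarrow> v \<in> V \<Longrightarrow> a u v = (\<Sum>k<N. w k u * w k v)" by blast
  have "(\<Sum>u\<in>V. \<Sum>v\<in>V. a u v * b u v) = (\<Sum>u\<in>V. \<Sum>v\<in>V. \<Sum>k<N. w k u * w k v * b u v)"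
    by (simp add: w sum_distrib_right cong: sum.cong)
  also have "\<dots> = (\<Sum>u\<in>V. \<Sum>k<N. \<Sum>v\<in>V. w k u * w k v * b u v)"
    by (intro sum.cong refl sum.swap)
  also have "\<dots> = (\<Sum>k<N. \<Sum>u\<in>V. \<Sum>v\<in>V. w k u * w k v * b u v)"
    by (rule sum.swap)
  also have "\<dots> \<ge> 0"
    by (intro sum_nonneg psd_on_nonneg assms(3))
  finally show ?thesis .
qed

section \<open>Matrices as kernels\<close>

text \<open>Only the first \<open>d\<close> values of a test function matter, so functions and
  vectors of dimension \<open>d\<close> test the same condition.\<close>

lemma psd_mats_iff:
  "A \<in> psd_mats d \<longleftrightarrow> A \<in> carrier_mat d d \<and> psd_on {..<d} (\<lambda>i j. A $$ (i, j))"
proof (cases "A \<in> carrier_mat d d")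
  case False
  then show ?thesis by (simp add: psd_mats_def sym_mats_def)
next
  case A: True
  then have dims: "dim_row A = d" "dim_col A = d" by auto
  have sym: "transpose_mat A = A \<longleftrightarrow> (\<forall>i\<in>{..<d}. \<forall>j\<in>{..<d}. A $$ (i, j) = A $$ (j, i))"
    using dims by (subst mat_eq_iff) (auto simp: transpose_mat_def)
  have form: "x \<bullet> (A *\<^sub>v x) = (\<Sum>i<d. \<Sum>j<d. x $ i * x $ j * A $$ (i, j))" if "x \<in> carrier_vec d" for x
  proof -
    have "x \<bullet> (A *\<^sub>v x) = (\<Sum>i<d. x $ i * (\<Sum>j<d. A $$ (i, j) * x $ j))"
      using that dims by (auto simp: scalar_prod_def atLeast0LessThan intro!: sum.cong)
    then show ?thesis by (simp add: sum_distrib_left mult_ac)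
  qed
  have "(\<forall>x\<in>carrier_vec d. 0 \<le> x \<bullet> (A *\<^sub>v x)) \<longleftrightarrow>
      (\<forall>x. 0 \<le> (\<Sum>i<d. \<Sum>j<d. x i * x j * A $$ (i, j)))" (is "?L \<longleftrightarrow> ?R")
  proof
    assume ?L
    show ?R
    proof
      fix x :: "nat \<Rightarrow> real"
      have "0 \<le> vec d x \<bullet> (A *\<^sub>v vec d x)" using \<open>?L\<close> by simp
      also have "\<dots> = (\<Sum>i<d. \<Sum>j<d. x i * x j * A $$ (i, j))"
        by (subst form) (auto intro!: sum.cong)
      finally show "0 \<le> (\<Sum>i<d. \<Sum>j<d. x i * x j * A $$ (i, j))" .
    qed
  next
    assume ?R
    then show ?L by (auto simp: form)
  qed
  then show ?thesis
    using A sym by (auto simp: psd_mats_def sym_mats_def psd_on_def)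
qed

text \<open>Symmetry of \<open>Y\<close> makes the trace form the Euclidean inner product of the
  entries, so that matrices can be treated as vectors.\<close>

lemma trace_inner_psd:
  assumes "X \<in> carrier_mat d d" "Y \<in> psd_mats d"
  shows "trace_inner X Y = (\<Sum>i<d. \<Sum>j<d. X $$ (i, j) * Y $$ (i, j))"
proof -
  have Y: "Y \<in> carrier_mat d d" and psd: "psd_on {..<d} (\<lambda>i j. Y $$ (i, j))"
    using assms(2) by (simp_all add: psd_mats_iff)
  have "trace_inner X Y = (\<Sum>i<d. \<Sum>j<d. X $$ (i, j) * Y $$ (j, i))"
    using assms(1) Y
    by (auto simp: trace_inner_def mat_trace_def scalar_prod_def atLeast0LessThan intro!: sum.cong)
  also have "\<dots> = (\<Sum>i<d. \<Sum>j<d. X $$ (i, j) * Y $$ (i, j))"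
    using psd_on_sym[OF psd] by (intro sum.cong refl arg_cong2[where f = "(*)"]) auto
  finally show ?thesis .
qed

lemma index_finsum_module_mat:
  assumes "finite A" "\<And>u. u \<in> A \<Longrightarrow> f u \<in> carrier_mat d d" "i < d" "j < d"
  shows "finsum (module_mat TYPE(real) d d) f A $$ (i, j) = (\<Sum>u\<in>A. f u $$ (i, j))"
proof -
  interpret M: abelian_group "module_mat TYPE(real) d d"
    by (rule abelian_group_mat)
  have carrier: "carrier (module_mat TYPE(real) d d) = carrier_mat d d"
    by (simp add: module_mat_simps)
  show ?thesis using assms(1,2)
  proof (induction A rule: finite_induct)
    case empty
    then show ?case using assms(3,4) by (simp add: module_mat_simps)
  next
    case (insert u A)
    then have cl: "finsum (module_mat TYPE(real) d d) f A \<in> carrier_mat d d"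
      using M.finsum_closed[of f A] carrier by auto
    have "finsum (module_mat TYPE(real) d d) f (insert u A) =
        f u + finsum (module_mat TYPE(real) d d) f A"
      using insert by (subst M.finsum_insert) (auto simp: module_mat_simps)
    then show ?case using insert cl assms(3,4) by auto
  qed
qed

section \<open>The feasible region of the theta problem\<close>

text \<open>The feasible region of the theta problem indexed by vertices, which removes the
  enumeration \<open>vs\<close>.\<close>

definition theta_kernel :: "'a pair_pre_digraph \<Rightarrow> ('a \<Rightarrow> 'a \<Rightarrow> real) \<Rightarrow> bool" where
  "theta_kernel G f \<longleftrightarrow> psd_on (pverts G) f \<and>
     (\<forall>u\<in>pverts G. \<forall>v\<in>pverts G. 0 \<le> f u v) \<and>
     (\<Sum>u\<in>pverts G. f u u) = 1 \<and>
     (\<forall>u\<in>pverts G. \<forall>v\<in>pverts G. (u, v) \<in> parcs G \<longrightarrow> f u v = 0)"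

lemma theta_kernel_cong:
  assumes "\<And>u v. u \<in> pverts G \<Longrightarrow> v \<in> pverts G \<Longrightarrow> f u v = g u v"
  shows "theta_kernel G f \<longleftrightarrow> theta_kernel G g"
  using psd_on_cong[of "pverts G" f g] unfolding theta_kernel_def
  by (simp add: assms cong: sum.cong)

text \<open>The diagonal is nonnegative with sum 1, and the test vector with values 1 at
  \<open>u\<close> and -1 at \<open>v\<close> bounds \<open>2 * f u v\<close> by
  \<open>f u u + f v v\<close>. This is the boundedness behind compactness.\<close>

lemma theta_kernel_le_1:
  assumes "finite (pverts G)" "theta_kernel G f" "u \<in> pverts G" "v \<in> pverts G"
  shows "f u v \<le> 1"
proof -
  have psd: "psd_on (pverts G) f" using assms by (simp add: theta_kernel_def)
  have diag: "f w w \<le> 1" if "w \<in> pverts G" for w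
    using assms(1,2) that member_le_sum[of w "pverts G" "\<lambda>w. f w w"]
    by (auto simp: theta_kernel_def)
  show ?thesis
  proof (cases "u = v")
    case True
    then show ?thesis using diag assms by simp
  next
    case False
    then show ?thesis
      using psd_on_two_points[OF assms(1) psd assms(3,4), of 1 "-1"] diag[OF assms(3)] diag[OF assms(4)]
      by simp
  qed
qed

lemma trace_inner_all_ones:
  assumes "X \<in> psd_mats d"
  shows "trace_inner (all_ones_mat d) X = (\<Sum>i<d. \<Sum>j<d. X $$ (i, j))"
  using assms by (subst trace_inner_psd) (auto simp: all_ones_mat_def)

text \<open>An enumeration and its inverse carry matrices to kernels and back without changing the
  objective, so \<open>theta_prime\<close> becomes a maximum over kernels.\<close>

lemma theta_prime_value_iff:
  assumes "finite (pverts G)"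
  shows "(\<exists>vs X. distinct vs \<and> set vs = pverts G \<and> theta_prime_feasible G vs X \<and>
        r = trace_inner (all_ones_mat (card (pverts G))) X) \<longleftrightarrow>
      (\<exists>f. theta_kernel G f \<and> r = (\<Sum>u\<in>pverts G. \<Sum>v\<in>pverts G. f u v))" (is "?L \<longleftrightarrow> ?R")
proof
  define n where "n = card (pverts G)"
  have nth: "bij_betw ((!) vs) {..<n} (pverts G)" if "distinct vs" "set vs = pverts G" for vs
    using that(1) by (rule bij_betw_nth) (use that distinct_card[of vs] in \<open>simp_all add: n_def\<close>)
  {
    assume ?L
    then obtain vs X where vs: "distinct vs" "set vs = pverts G"
      and X: "theta_prime_feasible G vs X" and r: "r = trace_inner (all_ones_mat n) X"
      unfolding n_def by blast
    note h = nth[OF vs]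
    define g where "g = inv_into {..<n} ((!) vs)"
    have g: "bij_betw g (pverts G) {..<n}"
      unfolding g_def using h by (rule bij_betw_inv_into)
    have g_less: "g u < n" if "u \<in> pverts G" for u
      using g that by (auto dest: bij_betwE)
    have nth_g: "vs ! g u = u" if "u \<in> pverts G" for u
      using h that by (simp add: g_def bij_betw_inv_into_right)
    have Xpsd: "X \<in> psd_mats n" and Xnonneg: "\<And>i j. i < n \<Longrightarrow> j < n \<Longrightarrow> 0 \<le> X $$ (i, j)"
      using X by (simp_all add: theta_prime_feasible_def dnn_mats_def n_def)
    then have dim: "dim_row X = n" by (auto simp: psd_mats_iff)
    have "theta_kernel G (\<lambda>u v. X $$ (g u, g v))"
      unfolding theta_kernel_def
    proof (intro conjI ballI impI)
      show "psd_on (pverts G) (\<lambda>u v. X $$ (g u, g v))"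
        using psd_on_reindex[OF _ g, of "\<lambda>i j. X $$ (i, j)"] Xpsd by (simp add: psd_mats_iff)
      show "(\<Sum>u\<in>pverts G. X $$ (g u, g u)) = 1"
        using X sum.reindex_bij_betw[OF g, of "\<lambda>i. X $$ (i, i)"]
        by (simp add: theta_prime_feasible_def mat_trace_def dim)
    next
      fix u v assume uv: "u \<in> pverts G" "v \<in> pverts G"
      then show "0 \<le> X $$ (g u, g v)" by (simp add: Xnonneg g_less)
      assume "(u, v) \<in> parcs G"
      then show "X $$ (g u, g v) = 0"
        using X uv g_less[unfolded n_def] by (simp add: theta_prime_feasible_def nth_g)
    qed
    moreover have "r = (\<Sum>u\<in>pverts G. \<Sum>v\<in>pverts G. X $$ (g u, g v))"
      unfolding r trace_inner_all_ones[OF Xpsd] by (simp flip: sum.reindex_bij_betw[OF g])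
    ultimately show ?R by blast
  }
  assume ?R
  then obtain f where f: "theta_kernel G f" and r: "r = (\<Sum>u\<in>pverts G. \<Sum>v\<in>pverts G. f u v)"
    by blast
  from finite_distinct_list[OF assms] obtain vs where vs: "set vs = pverts G" "distinct vs"
    by blast
  note h = nth[OF vs(2,1)]
  have nth_in: "vs ! i \<in> pverts G" if "i < n" for i
    using h that by (auto dest: bij_betwE)
  define X where "X = mat n n (\<lambda>(i, j). f (vs ! i) (vs ! j))"
  have X_carrier: "X \<in> carrier_mat n n" and X_index: "\<And>i j. i < n \<Longrightarrow> j < n \<Longrightarrow> X $$ (i, j) = f (vs ! i) (vs ! j)"
    by (simp_all add: X_def)
  have "psd_on {..<n} (\<lambda>i j. f (vs ! i) (vs ! j))"
    using psd_on_reindex[OF _ h] f by (simp add: theta_kernel_def)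
  also have "?this \<longleftrightarrow> psd_on {..<n} (\<lambda>i j. X $$ (i, j))"
    by (rule psd_on_cong) (simp add: X_index)
  finally have Xpsd: "X \<in> psd_mats n"
    using X_carrier by (simp add: psd_mats_iff)
  have "theta_prime_feasible G vs X"
    unfolding theta_prime_feasible_def n_def[symmetric]
  proof (intro conjI allI impI)
    show "X \<in> dnn_mats n"
      using Xpsd f by (auto simp: dnn_mats_def X_index theta_kernel_def nth_in)
    have "mat_trace X = (\<Sum>i<n. f (vs ! i) (vs ! i))"
      using X_carrier by (auto simp: mat_trace_def X_index)
    also have "\<dots> = (\<Sum>u\<in>pverts G. f u u)"
      by (rule sum.reindex_bij_betw[OF h])
    finally show "mat_trace X = 1" using f by (simp add: theta_kernel_def)
  next
    fix i j assume "i < n" "j < n" "(vs ! i, vs ! j) \<in> parcs G"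
    then show "X $$ (i, j) = 0"
      using f by (simp add: X_index theta_kernel_def nth_in)
  qed
  moreover have "r = trace_inner (all_ones_mat n) X"
    unfolding r trace_inner_all_ones[OF Xpsd]
    by (simp add: X_index flip: sum.reindex_bij_betw[OF h])
  ultimately show ?L using vs unfolding n_def by blast
qed

section \<open>Compactness and attainment of the maximum\<close>

lemma closed_Collect_ball:
  assumes "\<And>u. u \<in> A \<Longrightarrow> closed {x. P x u}"
  shows "closed {x. \<forall>u\<in>A. P x u}"
proof -
  have "{x. \<forall>u\<in>A. P x u} = (\<Inter>u\<in>A. {x. P x u})" by auto
  then show ?thesis using assms by (simp add: closed_INT)
qed

text \<open>Uncurrying places kernels in a product space, where the conditions are equations and
  weak inequalities between continuous functions of the coordinates.\<close>

lemma closed_theta_kernel: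
  "closed {F :: 'a \<times> 'a \<Rightarrow> real. theta_kernel G (\<lambda>u v. F (u, v))}"
proof -
  have coord: "continuous_on UNIV (\<lambda>F :: 'a \<times> 'a \<Rightarrow> real. F p)" for p
    by (rule continuous_on_product_coordinates)
  \<comment> \<open>The premise of the edge condition does not mention \<open>F\<close>, so the
    condition cuts out either a coordinate hyperplane or the whole space.\<close>
  have "closed {F :: 'a \<times> 'a \<Rightarrow> real. P \<longrightarrow> F p = 0}" for P p
    by (cases P) (auto intro!: closed_Collect_eq coord continuous_intros)
  then show ?thesis
    unfolding theta_kernel_def psd_on_def
    by (intro closed_Collect_conj closed_Collect_ball closed_Collect_all closed_Collect_eq
        closed_Collect_le coord continuous_intros)
qed

text \<open>The type \<open>'a\<close> may be infinite, so compactness comes from Tychonoff's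
  theorem for a cube over all pairs; a closed subset of it remains compact.\<close>

lemma theta_kernel_attains_max:
  assumes "finite (pverts G)" "theta_kernel G f"
  obtains h where "theta_kernel G h"
    and "\<And>g. theta_kernel G g \<Longrightarrow>
      (\<Sum>u\<in>pverts G. \<Sum>v\<in>pverts G. g u v) \<le> (\<Sum>u\<in>pverts G. \<Sum>v\<in>pverts G. h u v)"
proof -
  define box :: "('a \<times> 'a \<Rightarrow> real) set" where "box = PiE UNIV (\<lambda>_. {0..1})"
  define K where "K = {F. theta_kernel G (\<lambda>u v. F (u, v))} \<inter> box"
  \<comment> \<open>Entries off the vertex set are unconstrained; setting them to 0 moves a kernel
    into the cube without changing feasibility or objective.\<close>
  define ext where "ext g p = (if fst p \<in> pverts G \<and> snd p \<in> pverts G then g (fst p) (snd p) else 0)"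
    for g :: "'a \<Rightarrow> 'a \<Rightarrow> real" and p
  have ext: "ext g \<in> K" if g: "theta_kernel G g" for g
  proof -
    have "theta_kernel G (\<lambda>u v. ext g (u, v))"
      using g by (subst theta_kernel_cong[of G _ g]) (auto simp: ext_def)
    moreover have "ext g \<in> box"
      using theta_kernel_le_1[OF assms(1) g] g by (auto simp: box_def ext_def theta_kernel_def)
    ultimately show ?thesis by (simp add: K_def)
  qed
  have "compact box"
    unfolding box_def compactin_euclidean_iff[symmetric] euclidean_product_topology[symmetric]
    by (simp only: compactin_PiE compactin_euclidean_iff compact_Icc simp_thms ball_simps)
  then have "compact K"
    unfolding K_def by (intro closed_Int_compact closed_theta_kernel)
  moreover have "K \<noteq> {}" using ext[OF assms(2)] by blast
  moreover have "continuous_on K (\<lambda>F. \<Sum>u\<in>pverts G. \<Sum>v\<in>pverts G. F (u, v))"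
    by (intro continuous_intros continuous_on_subset[OF continuous_on_product_coordinates]) auto
  ultimately obtain F where F: "F \<in> K" and max: "\<And>F'. F' \<in> K \<Longrightarrow>
      (\<Sum>u\<in>pverts G. \<Sum>v\<in>pverts G. F' (u, v)) \<le> (\<Sum>u\<in>pverts G. \<Sum>v\<in>pverts G. F (u, v))"
    using continuous_attains_sup[of K] by blast
  show thesis
  proof
    show "theta_kernel G (\<lambda>u v. F (u, v))" using F by (simp add: K_def)
    show "(\<Sum>u\<in>pverts G. \<Sum>v\<in>pverts G. g u v) \<le> (\<Sum>u\<in>pverts G. \<Sum>v\<in>pverts G. F (u, v))"
      if "theta_kernel G g" for g
      using max[OF ext[OF that]] by (simp add: ext_def cong: sum.cong)
  qed
qed

text \<open>\<open>GREATEST\<close> on the reals is informative only when a maximum exists; the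
  maximizer \<open>h\<close> identifies its value.\<close>

lemma theta_kernel_le_theta_prime:
  assumes "finite (pverts G)" "theta_kernel G f"
  shows "(\<Sum>u\<in>pverts G. \<Sum>v\<in>pverts G. f u v) \<le> theta_prime G"
proof -
  from theta_kernel_attains_max[OF assms] obtain h where h: "theta_kernel G h"
    and max: "\<And>g. theta_kernel G g \<Longrightarrow>
      (\<Sum>u\<in>pverts G. \<Sum>v\<in>pverts G. g u v) \<le> (\<Sum>u\<in>pverts G. \<Sum>v\<in>pverts G. h u v)" by blast
  have "theta_prime G = (\<Sum>u\<in>pverts G. \<Sum>v\<in>pverts G. h u v)"
    unfolding theta_prime_def theta_prime_value_iff[OF assms(1)]
    by (rule Greatest_equality) (use h max in auto)
  then show ?thesis using max[OF assms(2)] by simp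
qed

section \<open>From feasible families to theta kernels\<close>

text \<open>The right side minus the left is half the sum of
  \<open>(x u - x v)\<^sup>2 * c u v\<close>.\<close>

lemma laplacian_nonneg:
  fixes c :: "'b \<Rightarrow> 'b \<Rightarrow> real"
  assumes "\<And>u v. u \<in> V \<Longrightarrow> v \<in> V \<Longrightarrow> 0 \<le> c u v" "\<And>u v. c u v = c v u"
  shows "(\<Sum>u\<in>V. \<Sum>v\<in>V. x u * x v * c u v) \<le> (\<Sum>u\<in>V. (x u)\<^sup>2 * (\<Sum>v\<in>V. c u v))"
proof -
  have sw: "(\<Sum>u\<in>V. \<Sum>v\<in>V. (x v)\<^sup>2 * c u v) = (\<Sum>u\<in>V. \<Sum>v\<in>V. (x u)\<^sup>2 * c u v)"
    by (subst sum.swap) (simp add: assms(2))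
  have "0 \<le> (\<Sum>u\<in>V. \<Sum>v\<in>V. (x u - x v)\<^sup>2 * c u v)"
    by (intro sum_nonneg mult_nonneg_nonneg assms) auto
  also have "\<dots> = (\<Sum>u\<in>V. \<Sum>v\<in>V. (x u)\<^sup>2 * c u v) + (\<Sum>u\<in>V. \<Sum>v\<in>V. (x v)\<^sup>2 * c u v)
      - 2 * (\<Sum>u\<in>V. \<Sum>v\<in>V. x u * x v * c u v)"
    unfolding sum_distrib_left sum.distrib[symmetric] sum_subtractf[symmetric]
    by (intro sum.cong refl) (simp add: power2_eq_square algebra_simps)
  finally have "(\<Sum>u\<in>V. \<Sum>v\<in>V. x u * x v * c u v) \<le> (\<Sum>u\<in>V. \<Sum>v\<in>V. (x u)\<^sup>2 * c u v)"
    unfolding sw by linarith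
  then show ?thesis by (simp only: sum_distrib_left)
qed

text \<open>The matrices appear here flattened to vectors over \<open>D\<close>, with
  \<open>g\<close> their Gram matrix; positive semidefiniteness enters through
  \<open>nonneg\<close>.\<close>

lemma theta_kernel_of_vectors:
  fixes R :: "nat \<Rightarrow> 'a \<Rightarrow> 'm \<Rightarrow> real" and s :: "'m \<Rightarrow> real" and D :: "'m set"
  defines "g \<equiv> \<lambda>i u j v. \<Sum>m\<in>D. R i u m * R j v m"
  assumes fin: "finite (pverts G)" and t: "1 \<le> t" and loopfree: "\<And>u. (u, u) \<notin> parcs G"
    and sum_R: "\<And>i m. i \<in> {1..t} \<Longrightarrow> m \<in> D \<Longrightarrow> (\<Sum>u\<in>pverts G. R i u m) = s m"
    and norm_s: "(\<Sum>m\<in>D. s m * s m) = 1"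
    and nonneg: "\<And>i j u v. \<lbrakk>i \<in> {1..t}; j \<in> {1..t}; u \<in> pverts G; v \<in> pverts G\<rbrakk> \<Longrightarrow> 0 \<le> g i u j v"
    and orth: "\<And>i j u v. \<lbrakk>i \<in> {1..t}; j \<in> {1..t}; i \<noteq> j; u \<in> pverts G; v \<in> pverts G;
      equal_or_adjacent G u v\<rbrakk> \<Longrightarrow> g i u j v = 0"
  obtains f where "theta_kernel G f" "(\<Sum>u\<in>pverts G. \<Sum>v\<in>pverts G. f u v) = real t"
proof -
  define V where "V = pverts G"
  define T where "T = {1..t}"
  have finT: "finite T" and cardT: "card T = t" by (simp_all add: T_def)
  have g_sym: "g i u j v = g j v i u" for i u j v
    by (simp add: g_def mult.commute)
  have g_bilin: "(\<Sum>u\<in>V. \<Sum>v\<in>V. x u * y v * g i u j v) =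
      (\<Sum>m\<in>D. (\<Sum>u\<in>V. x u * R i u m) * (\<Sum>v\<in>V. y v * R j v m))" for x y :: "'a \<Rightarrow> real" and i j
  proof -
    have "(\<Sum>u\<in>V. \<Sum>v\<in>V. x u * y v * g i u j v) =
        (\<Sum>u\<in>V. \<Sum>v\<in>V. \<Sum>m\<in>D. (x u * R i u m) * (y v * R j v m))"
      by (simp add: g_def sum_distrib_left mult_ac)
    also have "\<dots> = (\<Sum>u\<in>V. \<Sum>m\<in>D. \<Sum>v\<in>V. (x u * R i u m) * (y v * R j v m))"
      by (intro sum.cong refl sum.swap)
    also have "\<dots> = (\<Sum>m\<in>D. \<Sum>u\<in>V. \<Sum>v\<in>V. (x u * R i u m) * (y v * R j v m))"
      by (rule sum.swap)
    finally show ?thesis by (simp add: sum_product)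
  qed
  have g_total: "(\<Sum>u\<in>V. \<Sum>v\<in>V. g i u j v) = 1" if "i \<in> T" "j \<in> T" for i j
    using g_bilin[of "\<lambda>_. 1" "\<lambda>_. 1" i j] that norm_s
    by (simp add: sum_R V_def T_def cong: sum.cong)
  \<comment> \<open>\<open>f\<close> is the matrix X of the construction: \<open>a\<close> collects
    row sums of the diagonal blocks of \<open>g\<close>, and \<open>b\<close> adds up the blocks
    with distinct indices.\<close>
  define a where "a u = (\<Sum>i\<in>T. \<Sum>v\<in>V. g i u i v)" for u
  define b where "b u v = (\<Sum>i\<in>T. \<Sum>j\<in>T - {i}. g i u j v)" for u v
  define f where "f u v = ((if u = v then a u else 0) + b u v) / t" for u v
  have a_nonneg: "0 \<le> a u" if "u \<in> V" for u
    using that unfolding a_def by (intro sum_nonneg nonneg) (auto simp: V_def T_def)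
  have b_nonneg: "0 \<le> b u v" if "u \<in> V" "v \<in> V" for u v
    using that unfolding b_def by (intro sum_nonneg nonneg) (auto simp: V_def T_def)
  \<comment> \<open>\<open>equal_or_adjacent\<close> includes equality, so \<open>b\<close> vanishes
    on the diagonal too, which fixes the trace of \<open>f\<close>.\<close>
  have b_zero: "b u v = 0" if "u \<in> V" "v \<in> V" "equal_or_adjacent G u v" for u v
    using that unfolding b_def by (intro sum.neutral ballI orth) (auto simp: V_def T_def)
  \<comment> \<open>Completing the sum to all \<open>i\<close> and \<open>j\<close> exposes a Gram
    matrix, at the price of subtracting the diagonal blocks.\<close>
  have b_eq: "b u v = (\<Sum>i\<in>T. \<Sum>j\<in>T. g i u j v) - (\<Sum>i\<in>T. g i u i v)" for u v
    unfolding b_def using finT by (simp add: sum_diff1 sum_subtractf cong: sum.cong)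
  have b_sym: "b u v = b v u" for u v
    unfolding b_eq by (subst sum.swap) (simp add: g_sym[of _ u _ v])
  have sum_a: "(\<Sum>u\<in>V. a u) = t"
    unfolding a_def by (subst sum.swap) (simp add: g_total cardT)
  have sum_swap3: "(\<Sum>u\<in>V. \<Sum>v\<in>V. \<Sum>i\<in>T. h u v i) = (\<Sum>i\<in>T. \<Sum>u\<in>V. \<Sum>v\<in>V. h u v i)"
    for h :: "'a \<Rightarrow> 'a \<Rightarrow> nat \<Rightarrow> real"
  proof -
    have "(\<Sum>u\<in>V. \<Sum>v\<in>V. \<Sum>i\<in>T. h u v i) = (\<Sum>u\<in>V. \<Sum>i\<in>T. \<Sum>v\<in>V. h u v i)"
      by (intro sum.cong refl sum.swap)
    also have "\<dots> = (\<Sum>i\<in>T. \<Sum>u\<in>V. \<Sum>v\<in>V. h u v i)"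
      by (rule sum.swap)
    finally show ?thesis .
  qed
  have form_b: "(\<Sum>u\<in>V. \<Sum>v\<in>V. x u * x v * b u v) =
      (\<Sum>i\<in>T. \<Sum>j\<in>T. \<Sum>u\<in>V. \<Sum>v\<in>V. x u * x v * g i u j v) -
      (\<Sum>i\<in>T. \<Sum>u\<in>V. \<Sum>v\<in>V. x u * x v * g i u i v)" for x
    unfolding b_eq by (simp add: right_diff_distrib sum_subtractf sum_distrib_left sum_swap3)
  have form_f: "(\<Sum>u\<in>V. \<Sum>v\<in>V. x u * x v * f u v) =
      ((\<Sum>u\<in>V. (x u)\<^sup>2 * a u) + (\<Sum>u\<in>V. \<Sum>v\<in>V. x u * x v * b u v)) / t" for x
  proof -
    have "(\<Sum>u\<in>V. \<Sum>v\<in>V. x u * x v * f u v) =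
        ((\<Sum>u\<in>V. \<Sum>v\<in>V. if u = v then x u * x v * a u else 0) + (\<Sum>u\<in>V. \<Sum>v\<in>V. x u * x v * b u v)) / t"
      unfolding sum.distrib[symmetric] sum_divide_distrib
      by (intro sum.cong refl) (simp add: f_def algebra_simps)
    then show ?thesis using fin by (simp add: V_def power2_eq_square)
  qed
  have "psd_on V f"
    unfolding psd_on_def
  proof (intro conjI ballI allI)
    show "f u v = f v u" for u v
      by (simp add: f_def b_sym[of u v])
    fix x :: "'a \<Rightarrow> real"
    \<comment> \<open>For each coordinate \<open>m\<close> the sums over \<open>i\<close> and
      \<open>j\<close> factor into a square.\<close>
    have "(\<Sum>i\<in>T. \<Sum>j\<in>T. \<Sum>u\<in>V. \<Sum>v\<in>V. x u * x v * g i u j v) =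
        (\<Sum>i\<in>T. \<Sum>j\<in>T. \<Sum>m\<in>D. (\<Sum>u\<in>V. x u * R i u m) * (\<Sum>v\<in>V. x v * R j v m))"
      by (simp add: g_bilin)
    also have "\<dots> = (\<Sum>i\<in>T. \<Sum>m\<in>D. \<Sum>j\<in>T. (\<Sum>u\<in>V. x u * R i u m) * (\<Sum>v\<in>V. x v * R j v m))"
      by (intro sum.cong refl sum.swap)
    also have "\<dots> = (\<Sum>m\<in>D. \<Sum>i\<in>T. \<Sum>j\<in>T. (\<Sum>u\<in>V. x u * R i u m) * (\<Sum>v\<in>V. x v * R j v m))"
      by (rule sum.swap)
    also have "\<dots> = (\<Sum>m\<in>D. (\<Sum>i\<in>T. \<Sum>u\<in>V. x u * R i u m)\<^sup>2)"
      by (simp only: sum_product power2_eq_square)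
    also have "\<dots> \<ge> 0"
      by (intro sum_nonneg) simp
    finally have full: "0 \<le> (\<Sum>i\<in>T. \<Sum>j\<in>T. \<Sum>u\<in>V. \<Sum>v\<in>V. x u * x v * g i u j v)" .
    \<comment> \<open>One Laplacian for each \<open>i\<close>: the diagonal built from
      \<open>a\<close> pays for the subtracted diagonal blocks.\<close>
    have "(\<Sum>i\<in>T. \<Sum>u\<in>V. \<Sum>v\<in>V. x u * x v * g i u i v) \<le>
        (\<Sum>i\<in>T. \<Sum>u\<in>V. (x u)\<^sup>2 * (\<Sum>v\<in>V. g i u i v))"
      by (intro sum_mono laplacian_nonneg nonneg g_sym) (auto simp: V_def T_def)
    also have "\<dots> = (\<Sum>u\<in>V. (x u)\<^sup>2 * a u)"
      unfolding a_def by (subst sum.swap) (simp only: sum_distrib_left)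
    finally show "0 \<le> (\<Sum>u\<in>V. \<Sum>v\<in>V. x u * x v * f u v)"
      using full by (simp add: form_f form_b)
  qed
  moreover have "0 \<le> f u v" if "u \<in> V" "v \<in> V" for u v
    using a_nonneg b_nonneg that by (simp add: f_def)
  moreover have "(\<Sum>u\<in>V. f u u) = 1"
  proof -
    have "(\<Sum>u\<in>V. f u u) = (\<Sum>u\<in>V. a u / t)"
      by (intro sum.cong refl) (simp add: f_def b_zero equal_or_adjacent_def)
    then show ?thesis using sum_a t by (simp flip: sum_divide_distrib)
  qed
  \<comment> \<open>Without loops an edge has distinct ends, so the diagonal term is absent.\<close>
  moreover have "f u v = 0" if "u \<in> V" "v \<in> V" "(u, v) \<in> parcs G" for u v
    using that loopfree by (auto simp: f_def b_zero equal_or_adjacent_def)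
  ultimately have "theta_kernel G f"
    by (simp add: theta_kernel_def V_def)
  \<comment> \<open>The constant test vector 1 evaluates the objective; every block of
    \<open>g\<close> has total 1.\<close>
  moreover have "(\<Sum>u\<in>V. \<Sum>v\<in>V. f u v) = t"
    using form_f[of "\<lambda>_. 1"] form_b[of "\<lambda>_. 1"] sum_a t by (simp add: g_total cardT)
  ultimately show thesis using that by (simp add: V_def)
qed

text \<open>Matrix entries serve as the vectors, and self-duality of the cone makes their inner
  products nonnegative. The bound \<open>1 \<le> t\<close> allows the normalization by
  \<open>t\<close>.\<close>

lemma alpha_star_feasible_le_theta_prime:
  assumes G: "pair_graph G" and t: "1 \<le> t" and feas: "alpha_star_feasible G t d \<rho> P"
  shows "real t \<le> theta_prime G"
proof -
  interpret pair_graph G by (rule G)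
  note fin = pair_finite_verts
  define D where "D = {..<d} \<times> {..<d}"
  have P: "P i u \<in> psd_mats d" if "i \<in> {1..t}" "u \<in> pverts G" for i u
    using feas that by (simp add: alpha_star_feasible_def)
  have rho: "\<rho> \<in> psd_mats d" and rho1: "trace_inner \<rho> \<rho> = 1"
    using feas by (simp_all add: alpha_star_feasible_def)
  have inner: "trace_inner X Y = (\<Sum>m\<in>D. X $$ m * Y $$ m)"
    if "X \<in> psd_mats d" "Y \<in> psd_mats d" for X Y
    using that by (subst trace_inner_psd) (auto simp: psd_mats_iff D_def sum.cartesian_product split_def)
  have inner_nonneg: "0 \<le> trace_inner X Y" if "X \<in> psd_mats d" "Y \<in> psd_mats d" for X Y
    using that psd_on_inner_nonneg[of "{..<d}"]
    by (subst trace_inner_psd) (auto simp: psd_mats_iff)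
  obtain f where "theta_kernel G f" "(\<Sum>u\<in>pverts G. \<Sum>v\<in>pverts G. f u v) = real t"
  proof (rule theta_kernel_of_vectors[of G t "{..<d} \<times> {..<d}" "\<lambda>i u m. P i u $$ m" "\<lambda>m. \<rho> $$ m", folded D_def])
    show "(u, u) \<notin> parcs G" for u
      using pair_no_loops[of "(u, u)"] by auto
    show "(\<Sum>u\<in>pverts G. P i u $$ m) = \<rho> $$ m" if i: "i \<in> {1..t}" and "m \<in> D" for i m
    proof -
      obtain k l where m: "m = (k, l)" "k < d" "l < d" using \<open>m \<in> D\<close> by (auto simp: D_def)
      have "\<rho> = finsum (module_mat TYPE(real) d d) (\<lambda>u. P i u) (pverts G)"
        using feas i by (simp add: alpha_star_feasible_def)
      then show ?thesis
        using m P[OF i] by (simp add: index_finsum_module_mat[OF fin] psd_mats_iff)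
    qed
    show "(\<Sum>m\<in>D. \<rho> $$ m * \<rho> $$ m) = 1"
      using inner[OF rho rho] rho1 by simp
    show "0 \<le> (\<Sum>m\<in>D. P i u $$ m * P j v $$ m)"
      if "i \<in> {1..t}" "j \<in> {1..t}" "u \<in> pverts G" "v \<in> pverts G" for i j u v
      using inner_nonneg[OF P P] inner[OF P P] that by simp
    show "(\<Sum>m\<in>D. P i u $$ m * P j v $$ m) = 0"
      if "i \<in> {1..t}" "j \<in> {1..t}" "i \<noteq> j" "u \<in> pverts G" "v \<in> pverts G" "equal_or_adjacent G u v"
      for i j u v
      using feas that by (simp add: alpha_star_feasible_def flip: inner[OF P P])
  qed (use fin t in auto)
  then show ?thesis using theta_kernel_le_theta_prime[OF fin] by metis
qed

section \<open>Stable sets as feasible families, and the chain of inequalities\<close>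

text \<open>Number the elements of \<open>S\<close> by \<open>s\<close> and let the scalar
  \<open>P i u\<close> indicate \<open>u = s i\<close>. Injectivity of \<open>s\<close> and
  stability of \<open>S\<close> give condition (c).\<close>

lemma stable_set_alpha_q_feasible:
  assumes G: "pair_graph G" and S: "stable_set G S"
  shows "\<exists>\<rho> P. alpha_q_feasible G (card S) 1 \<rho> P"
proof -
  interpret pair_graph G by (rule G)
  note fin = pair_finite_verts
  have sub: "S \<subseteq> pverts G" using S by (simp add: stable_set_def)
  then have "finite S" using fin finite_subset by blast
  then obtain s where s: "bij_betw s {1..card S} S"
    using ex_bij_betw_nat_finite_1 by blast
  have s_in: "s i \<in> S" if "i \<in> {1..card S}" for i
    using s that by (auto dest: bij_betwE)
  define P :: "nat \<Rightarrow> 'a \<Rightarrow> real mat" where "P i u = mat 1 1 (\<lambda>_. if u = s i then 1 else 0)" for i u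
  have P_carrier: "P i u \<in> carrier_mat 1 1" for i u by (simp add: P_def)
  have one: "1\<^sub>m 1 \<in> psd_mats 1"
    by (auto simp: psd_mats_iff psd_on_def)
  have P_psd: "P i u \<in> psd_mats 1" for i u
    by (auto simp: psd_mats_iff psd_on_def P_def)
  have inner: "trace_inner (P i u) (P j v) = (if u = s i \<and> v = s j then 1 else 0)" for i u j v
    by (subst trace_inner_psd[OF P_carrier P_psd]) (simp add: P_def)
  have "alpha_star_feasible G (card S) 1 (1\<^sub>m 1) P"
    unfolding alpha_star_feasible_def
  proof (intro conjI ballI impI)
    show "trace_inner (1\<^sub>m 1) (1\<^sub>m 1) = 1"
      by (subst trace_inner_psd[OF _ one]) auto
  next
    fix i assume i: "i \<in> {1..card S}"
    interpret M: abelian_group "module_mat TYPE(real) 1 1"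
      by (rule abelian_group_mat)
    have "finsum (module_mat TYPE(real) 1 1) (\<lambda>u. P i u) (pverts G) \<in> carrier_mat 1 1"
      using M.finsum_closed[of "\<lambda>u. P i u" "pverts G"] P_carrier by (auto simp: module_mat_simps)
    moreover have "finsum (module_mat TYPE(real) 1 1) (\<lambda>u. P i u) (pverts G) $$ (0, 0) = 1"
      using s_in[OF i] sub by (subst index_finsum_module_mat[OF fin P_carrier]) (auto simp: P_def fin)
    ultimately show "finsum (module_mat TYPE(real) 1 1) (\<lambda>u. P i u) (pverts G) = 1\<^sub>m 1"
      by (intro eq_matI) auto
  next
    fix i j u v
    assume ij: "i \<in> {1..card S}" "j \<in> {1..card S}" "i \<noteq> j" and adj: "equal_or_adjacent G u v"
    have "\<not> (u = s i \<and> v = s j)"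
    proof
      assume uv: "u = s i \<and> v = s j"
      then have "u \<noteq> v"
        using ij inj_onD[OF bij_betw_imp_inj_on[OF s], of i j] by blast
      moreover have "(u, v) \<notin> parcs G"
        using S s_in[OF ij(1)] s_in[OF ij(2)] uv by (simp add: stable_set_def)
      ultimately show False using adj by (simp add: equal_or_adjacent_def)
    qed
    then show "trace_inner (P i u) (P j v) = 0" by (simp only: inner if_False)
  qed (use one P_psd in auto)
  moreover have "trace_inner (P i u) (P i v) = 0" if "u \<noteq> v" for i u v
    using that by (auto simp: inner)
  ultimately show ?thesis unfolding alpha_q_feasible_def by blast
qed

theorem corollary4p7:
  fixes G :: "'a pair_pre_digraph"
  assumes "pair_graph G" and "pverts G \<noteq> {}"
  shows "stability_number G \<le> alpha_q G \<and> alpha_q G \<le> alpha_star G \<and>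
         int (alpha_star G) \<le> \<lfloor>theta_prime G\<rfloor>"
proof -
  interpret pair_graph G by (rule assms(1))
  define Q where "Q t \<longleftrightarrow> (\<exists>d\<ge>1. \<exists>\<rho> P. alpha_q_feasible G t d \<rho> P)" for t
  define A where "A t \<longleftrightarrow> (\<exists>d\<ge>1. \<exists>\<rho> P. alpha_star_feasible G t d \<rho> P)" for t
  have q: "alpha_q G = (GREATEST t. Q t)" and star: "alpha_star G = (GREATEST t. A t)"
    by (simp_all add: alpha_q_def alpha_star_def Q_def A_def)
  have QA: "A t" if "Q t" for t
    using that by (auto simp: Q_def A_def alpha_q_feasible_def)
  have A_theta: "real t \<le> theta_prime G" if "A t" "1 \<le> t" for t
    using that alpha_star_feasible_le_theta_prime[OF assms(1)] by (auto simp: A_def)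
  \<comment> \<open>Boundedness makes both \<open>GREATEST\<close> terms attained maxima. The case
    \<open>t = 0\<close>, outside \<open>A_theta\<close>, holds because the bound is a natural
    number.\<close>
  have A_bound: "t \<le> nat \<lfloor>theta_prime G\<rfloor>" if "A t" for t
    using A_theta[OF that] by (cases "t = 0") (auto simp: le_nat_floor)
  have stable_Q: "Q (card S)" if "stable_set G S" for S
    using stable_set_alpha_q_feasible[OF assms(1) that] by (auto simp: Q_def)
  have stable_sub: "S \<subseteq> pverts G" if "stable_set G S" for S
    using that by (simp add: stable_set_def)
  have "finite {S. stable_set G S}"
    by (rule finite_subset[of _ "Pow (pverts G)"]) (use stable_sub pair_finite_verts in auto)
  then have finC: "finite {card S |S. stable_set G S}"
    by (simp add: setcompr_eq_image)
  obtain v where v: "v \<in> pverts G" using assms(2) by blast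
  \<comment> \<open>A nonempty vertex set makes every number in the chain at least 1, as
    \<open>A_theta\<close> requires at \<open>alpha_star G\<close>.\<close>
  have single: "stable_set G {v}"
    using v pair_no_loops[of "(v, v)"] by (auto simp: stable_set_def)
  have "stability_number G \<in> {card S |S. stable_set G S}"
    unfolding stability_number_def using finC single by (intro Max_in) auto
  then have Q_stab: "Q (stability_number G)" using stable_Q by auto
  have "1 \<le> stability_number G"
    unfolding stability_number_def using finC single
    by (intro Max_ge) (auto intro!: exI[of _ "{v}"])
  moreover have stab_q: "stability_number G \<le> alpha_q G"
    unfolding q using Q_stab QA A_bound by (intro Greatest_le_nat) auto
  moreover have "Q (alpha_q G)"
    unfolding q using Q_stab QA A_bound by (intro GreatestI_nat[of Q "stability_number G"]) auto
  then have q_star: "alpha_q G \<le> alpha_star G"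
    unfolding star using QA A_bound by (intro Greatest_le_nat) auto
  moreover have "A (alpha_star G)"
    unfolding star using QA[OF Q_stab] A_bound by (intro GreatestI_nat[of A "stability_number G"]) auto
  ultimately have "real (alpha_star G) \<le> theta_prime G"
    by (intro A_theta) auto
  then show ?thesis using stab_q q_star by (simp add: le_floor_iff)
qed

end
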